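(* Let $E=(N,C,A,k)$ be an election with $m=|C|$ candidates, let $r=m-k$, and let $W$ be the committee returned by Reverse Sequential PAV on $E$. Then $W$ satisfies $\frac1r$-EJR. Moreover (even when $W$ fails EJR), for every integer $\ell\ge1$ satisfying $\ell>k\left(1-\frac1r\right)$, every $\ell$-cohesive group $V\subseteq N$ satisfies the EJR requirement, i.e., there exists a voter $i\in V$ with $|A_i\cap W|\ge\ell$.
   Context: An election is a tuple $E=(N,C,A,k)$, where $N=\{1,\ldots,n\}$ is a set of voters, $C$ is a set of $m$ candidates, $A=(A_i)_{i\in N}$ is a profile of approval ballots $A_i\subseteq C$, and $k$ is the desired committee size. It is assumed that $1\le k<m$ and that $A_i\ne\emptyset$ for at least one voter $i$. A committee is a set $W\subseteq C$ with $|W|=k$. For an integer $t\ge 0$, $H(t)=\sum_{j=1}^{t}1/j$ (so $H(0)=0$). For $S\subseteq C$, $\operatorname{PAV}(S)=\sum_{i\in N}H(|A_i\cap S|)$, and for $c\in S$ the marginal loss is $\Delta_S(c)=\operatorname{PAV}(S)-\operatorname{PAV}(S\setminus\{c\})$. Reverse Sequential PAV: let $C_m=C$; for $s=m,m-1,\ldots,k+1$ pick $c_s\in\arg\min_{c\in C_s}\Delta_{C_s}(c)$ and set $C_{s-1}=C_s\setminus\{c_s\}$; return $W=C_k$. Ties are resolved using a fixed priority (linear) order on candidates. For an integer $\ell\ge1$, a group of voters $V\subseteq N$ is $\ell$-cohesive if $|V|\ge \ell n/k$ and $|\bigcap_{i\in V}A_i|\ge \ell$. A committee $W$ satisfies EJR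 if for every integer $\ell\ge1$ and every $\ell$-cohesive group $V$ there is a voter $i\in V$ with $|A_i\cap W|\ge\ell$. For $\beta\in(0,1]$, a committee $W$ satisfies $\beta$-EJR if for every integer $\ell\ge1$ and every group $V\subseteq N$ with $|V|\ge\frac{1}{\beta}\,\ell\,\frac{n}{k}$ and $|\bigcap_{i\in V}A_i|\ge\ell$, there exists a voter $i\in V$ with $|A_i\cap W|\ge\ell$. *)

theory Defs
  imports "HOL-Analysis.Harmonic_Numbers"
begin

definition election :: "nat \<Rightarrow> 'c set \<Rightarrow> (nat \<Rightarrow> 'c set) \<Rightarrow> nat \<Rightarrow> bool" where
  "election n C A k \<longleftrightarrow>
     finite C \<and> (\<forall>i\<in>{1..n}. A i \<subseteq> C) \<and> 1 \<le> k \<and> k < card C \<and> (\<exists>i\<in>{1..n}. A i \<noteq> {})"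

definition committee :: "'c set \<Rightarrow> nat \<Rightarrow> 'c set \<Rightarrow> bool" where
  "committee C k W \<longleftrightarrow> W \<subseteq> C \<and> card W = k"

definition PAV :: "nat \<Rightarrow> (nat \<Rightarrow> 'c set) \<Rightarrow> 'c set \<Rightarrow> real" where
  "PAV n A S = (\<Sum>i\<in>{1..n}. harm (card (A i \<inter> S)))"

definition marginal_loss :: "nat \<Rightarrow> (nat \<Rightarrow> 'c set) \<Rightarrow> 'c set \<Rightarrow> 'c \<Rightarrow> real" where
  "marginal_loss n A S c = PAV n A S - PAV n A (S - {c})"

definition least_loss :: "nat \<Rightarrow> (nat \<Rightarrow> 'c set) \<Rightarrow> 'c set \<Rightarrow> 'c set" where
  "least_loss n A S = {c. is_arg_min (marginal_loss n A S) (\<lambda>c. c \<in> S) c}"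

text \<open>
  Ties are broken by a linear order \<open>prio\<close> on the candidates: among the candidates of least
  marginal loss, the \<open>prio\<close>-least one is removed. As \<open>prio\<close> is arbitrary, the direction of the
  order is immaterial.
\<close>

definition removed_candidate ::
    "nat \<Rightarrow> (nat \<Rightarrow> 'c set) \<Rightarrow> 'c rel \<Rightarrow> 'c set \<Rightarrow> 'c" where
  "removed_candidate n A prio S =
     (THE c. c \<in> least_loss n A S \<and> (\<forall>d\<in>least_loss n A S. (c, d) \<in> prio))"

text \<open>The candidates remaining after \<open>j\<close> removals, i.e. the set $C_{m-j}$.\<close>

primrec remaining ::
    "nat \<Rightarrow> 'c set \<Rightarrow> (nat \<Rightarrow> 'c set) \<Rightarrow> 'c rel \<Rightarrow> nat \<Rightarrow> 'c set" where
  "remaining n C A prio 0 = C"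
| "remaining n C A prio (Suc j) =
     remaining n C A prio j - {removed_candidate n A prio (remaining n C A prio j)}"

definition reverse_seq_PAV ::
    "nat \<Rightarrow> 'c set \<Rightarrow> (nat \<Rightarrow> 'c set) \<Rightarrow> nat \<Rightarrow> 'c rel \<Rightarrow> 'c set" where
  "reverse_seq_PAV n C A k prio = remaining n C A prio (card C - k)"

text \<open>
  Since an election has at least one voter, and \<open>l \<ge> 1\<close> wherever the next two notions are used,
  the size bounds force \<open>V\<close> to be nonempty; the degenerate intersection over the empty group
  never matters.
\<close>

definition cohesive ::
    "nat \<Rightarrow> (nat \<Rightarrow> 'c set) \<Rightarrow> nat \<Rightarrow> nat \<Rightarrow> nat set \<Rightarrow> bool" where
  "cohesive n A k l V \<longleftrightarrow>
     V \<subseteq> {1..n} \<and> real (card V) \<ge> real l * real n / real k \<and> card (\<Inter>i\<in>V. A i) \<ge> l"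

definition beta_EJR ::
    "real \<Rightarrow> nat \<Rightarrow> (nat \<Rightarrow> 'c set) \<Rightarrow> nat \<Rightarrow> 'c set \<Rightarrow> bool" where
  "beta_EJR \<beta> n A k W \<longleftrightarrow>
     (\<forall>l\<ge>1. \<forall>V\<subseteq>{1..n}.
        real (card V) \<ge> 1 / \<beta> * real l * (real n / real k) \<and> card (\<Inter>i\<in>V. A i) \<ge> l \<longrightarrow>
        (\<exists>i\<in>V. card (A i \<inter> W) \<ge> l))"

lemma removed_candidate_least_loss:
  assumes "finite C" "linear_order_on C prio" "S \<subseteq> C" "S \<noteq> {}"
  shows "removed_candidate n A prio S \<in> least_loss n A S"
    and "\<forall>d\<in>least_loss n A S. (removed_candidate n A prio S, d) \<in> prio"
proof -
  let ?L = "least_loss n A S"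
  have "finite S" using assms finite_subset by blast
  have sub: "?L \<subseteq> S" by (auto simp: least_loss_def is_arg_min_def)
  have fin: "finite ?L" using sub \<open>finite S\<close> finite_subset by blast
  have ne: "?L \<noteq> {}"
    using ex_is_arg_min_if_finite[OF \<open>finite S\<close> \<open>S \<noteq> {}\<close>, of "marginal_loss n A S"]
    by (auto simp: least_loss_def)
  have ord: "refl_on C prio" "trans prio" "antisym prio" "total_on C prio"
    using assms(2) by (auto simp: order_on_defs)
  have least: "\<exists>c\<in>L. \<forall>d\<in>L. (c, d) \<in> prio" if "finite L" "L \<noteq> {}" "L \<subseteq> C" for L
    using that
  proof (induction L rule: finite_ne_induct)
    case (singleton x)
    then show ?case using ord(1) by (auto simp: refl_on_def)
  next
    case (insert x F)
    then obtain c where c: "c \<in> F" "\<forall>d\<in>F. (c, d) \<in> prio" by auto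
    have refl: "(x, x) \<in> prio" "(c, c) \<in> prio"
      using insert.prems c ord(1) by (auto simp: refl_on_def)
    have "(x, c) \<in> prio \<or> (c, x) \<in> prio"
      using insert.prems c refl ord(4) by (cases "x = c") (auto simp: total_on_def)
    then show ?case
      using c refl ord(2) by (auto elim: transE)
  qed
  obtain c where "c \<in> ?L \<and> (\<forall>d\<in>?L. (c, d) \<in> prio)"
    using least[OF fin ne] sub assms(3) by blast
  moreover have "e = c" if "e \<in> ?L \<and> (\<forall>d\<in>?L. (e, d) \<in> prio)" for e
    using that calculation ord(3) by (auto dest: antisymD)
  ultimately have "removed_candidate n A prio S \<in> ?L \<and>
      (\<forall>d\<in>?L. (removed_candidate n A prio S, d) \<in> prio)"
    unfolding removed_candidate_def by (rule theI)
  then show "removed_candidate n A prio S \<in> ?L"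
    "\<forall>d\<in>?L. (removed_candidate n A prio S, d) \<in> prio" by auto
qed

lemma remaining_subset_card:
  assumes "finite C" "linear_order_on C prio" "j \<le> card C"
  shows "remaining n C A prio j \<subseteq> C \<and> card (remaining n C A prio j) = card C - j"
  using assms(3)
proof (induction j)
  case 0
  then show ?case by simp
next
  case (Suc j)
  let ?S = "remaining n C A prio j"
  have S: "?S \<subseteq> C" "card ?S = card C - j" using Suc by auto
  then have "?S \<noteq> {}" using Suc.prems by auto
  then have "removed_candidate n A prio ?S \<in> ?S"
    using removed_candidate_least_loss(1)[OF assms(1,2) S(1)]
    by (auto simp: least_loss_def is_arg_min_def)
  then show ?case using S by (auto simp: card_Diff_singleton)
qed

lemma committee_reverse_seq_PAV:
  assumes "election n C A k" "linear_order_on C prio"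
  shows "committee C k (reverse_seq_PAV n C A k prio)"
  using assms remaining_subset_card[of C prio "card C - k" n A]
  by (auto simp: election_def committee_def reverse_seq_PAV_def)

end

theory Submission
  imports Defs
begin

text \<open>
  Summed over all \<open>c \<in> S\<close>, a voter contributes at most $1$ to the marginal losses, so the removed
  candidate has marginal loss at most $n / |S|$. Suppose every voter of \<open>V\<close> has fewer than \<open>l\<close>
  representatives in \<open>W\<close>. Then some jointly approved \<open>c\<close> is removed, from a set \<open>S\<close> of size
  $k + j$ with $1 \<le> j \<le> r$; there every voter of \<open>V\<close> has at most $l - 1 + j$
  representatives, so \<open>c\<close> has marginal loss at least $|V| / (l - 1 + j)$. Hence
  $|V| (k + j) \<le> n (l - 1 + j)$, which contradicts either lower bound on $|V|$.
\<close>

text \<open>For an approver of \<open>c\<close> the count of approved members drops by exactly one,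
  so the harmonic difference is its last term; other voters lose nothing.\<close>

lemma marginal_loss_eq:
  assumes "finite S" "c \<in> S"
  shows "marginal_loss n A S c =
    (\<Sum>i\<in>{1..n}. if c \<in> A i then 1 / real (card (A i \<inter> S)) else 0)"
proof -
  have "harm (card (A i \<inter> S)) - harm (card (A i \<inter> (S - {c}))) =
      (if c \<in> A i then 1 / real (card (A i \<inter> S)) else 0)" for i
  proof (cases "c \<in> A i")
    case True
    have fin: "finite (A i \<inter> S)" and c: "c \<in> A i \<inter> S" using assms True by auto
    have eq: "A i \<inter> (S - {c}) = A i \<inter> S - {c}" by blast
    have "card (A i \<inter> S) = Suc (card (A i \<inter> (S - {c})))"
      unfolding eq using card_Suc_Diff1[OF fin c] by simp
    then show ?thesis using True by (simp add: harm_Suc inverse_eq_divide)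
  next
    case False
    then have "A i \<inter> (S - {c}) = A i \<inter> S" by blast
    then show ?thesis using False by simp
  qed
  then show ?thesis
    unfolding marginal_loss_def PAV_def by (simp flip: sum_subtractf)
qed

lemma sum_marginal_loss_le:
  assumes "finite S"
  shows "(\<Sum>c\<in>S. marginal_loss n A S c) \<le> real n"
proof -
  have "(\<Sum>c\<in>S. marginal_loss n A S c) =
      (\<Sum>c\<in>S. \<Sum>i\<in>{1..n}. if c \<in> A i then 1 / real (card (A i \<inter> S)) else 0)"
    using assms by (intro sum.cong refl marginal_loss_eq)
  also have "\<dots> = (\<Sum>i\<in>{1..n}. \<Sum>c\<in>S. if c \<in> A i then 1 / real (card (A i \<inter> S)) else 0)"
    by (rule sum.swap)
  also have "\<dots> \<le> (\<Sum>i\<in>{1..n}. 1)"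
  proof (rule sum_mono)
    fix i
    have "(\<Sum>c\<in>S. if c \<in> A i then 1 / real (card (A i \<inter> S)) else 0) =
        (\<Sum>c\<in>S \<inter> A i. 1 / real (card (A i \<inter> S)))"
      by (simp only: sum.inter_restrict[OF assms])
    then show "(\<Sum>c\<in>S. if c \<in> A i then 1 / real (card (A i \<inter> S)) else 0) \<le> 1"
      \<comment> \<open>The sum is \<open>card (A i \<inter> S)\<close> copies of its own
        reciprocal: 1, or 0 if the voter approves nothing in \<open>S\<close>.\<close>
      by (simp add: Int_commute)
  qed
  finally show ?thesis by simp
qed

lemma least_loss_le_average:
  assumes "finite S" "c \<in> least_loss n A S"
  shows "real (card S) * marginal_loss n A S c \<le> real n"
proof -
  have "real (card S) * marginal_loss n A S c = (\<Sum>d\<in>S. marginal_loss n A S c)"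
    by simp
  also have "\<dots> \<le> (\<Sum>d\<in>S. marginal_loss n A S d)"
    using assms(2) by (intro sum_mono) (auto simp: least_loss_def is_arg_min_linorder)
  also have "\<dots> \<le> real n" by (rule sum_marginal_loss_le[OF assms(1)])
  finally show ?thesis .
qed

text \<open>Each voter of \<open>V\<close> alone accounts for at least 1/\<open>q\<close> of the
  loss, and voters outside \<open>V\<close> contribute nonnegative terms.\<close>

lemma marginal_loss_ge_group:
  assumes "finite S" "c \<in> S" "V \<subseteq> {1..n}"
    and "\<And>i. i \<in> V \<Longrightarrow> c \<in> A i" "\<And>i. i \<in> V \<Longrightarrow> card (A i \<inter> S) \<le> q"
  shows "real (card V) \<le> real q * marginal_loss n A S c"
proof -
  have "real (card V) = (\<Sum>i\<in>V. 1)" by simp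
  also have "\<dots> \<le> (\<Sum>i\<in>V. real q * (1 / real (card (A i \<inter> S))))"
  proof (rule sum_mono)
    fix i assume i: "i \<in> V"
    \<comment> \<open>The candidate \<open>c\<close> itself lies in the intersection; this excludes
      the default value 1/0 = 0.\<close>
    then have "card (A i \<inter> S) > 0" using assms by (auto simp: card_gt_0_iff)
    then show "1 \<le> real q * (1 / real (card (A i \<inter> S)))"
      using assms(5)[OF i] by simp
  qed
  also have "\<dots> = real q * (\<Sum>i\<in>V. if c \<in> A i then 1 / real (card (A i \<inter> S)) else 0)"
    using assms(4) by (simp add: sum_distrib_left)
  also have "\<dots> \<le> real q * marginal_loss n A S c"
    unfolding marginal_loss_eq[OF assms(1,2)] using assms(3)
    by (intro mult_left_mono sum_mono2) auto
  finally show ?thesis .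
qed

lemma antimono_remaining: "antimono (remaining n C A prio)"
  by (rule antimonoI, rule lift_Suc_antimono_le) auto

lemma removal_step_exists:
  assumes "c \<in> C" "c \<notin> remaining n C A prio t"
  obtains j where "j < t" "c \<in> remaining n C A prio j"
    "c = removed_candidate n A prio (remaining n C A prio j)"
proof -
  have "\<exists>j<t. c \<in> remaining n C A prio j \<and>
      c = removed_candidate n A prio (remaining n C A prio j)"
    using assms(2)
  proof (induction t)
    case 0
    then show ?case using assms(1) by simp
  next
    case (Suc t)
    then show ?case by (cases "c \<in> remaining n C A prio t") (auto intro: less_SucI)
  qed
  then show thesis using that by blast
qed

text \<open>The inequality retains the unknown removal time through \<open>j\<close>, so that both
  claims can be refuted from it by ruling out every possible \<open>j\<close>.\<close>

lemma underrepresented_group_bound: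
  assumes el: "election n C A k" and lin: "linear_order_on C prio"
    and V: "V \<subseteq> {1..n}" "V \<noteq> {}" and l: "card (\<Inter>i\<in>V. A i) \<ge> l"
    and under: "\<And>i. i \<in> V \<Longrightarrow> card (A i \<inter> reverse_seq_PAV n C A k prio) < l"
  obtains j where "1 \<le> j" "j \<le> card C - k"
    "real (card V) * (real k + real j) \<le> real n * (real l - 1 + real j)"
proof -
  define W where "W = reverse_seq_PAV n C A k prio"
  have fin: "finite C" and k: "k < card C" using el by (auto simp: election_def)
  have W: "W \<subseteq> C" "card W = k"
    using committee_reverse_seq_PAV[OF el lin] by (auto simp: committee_def W_def)
  have finW: "finite W" using W fin finite_subset by blast
  obtain i0 where i0: "i0 \<in> V" using V by blast
  have l1: "1 \<le> l" using under[OF i0] by simp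
  have TC: "(\<Inter>i\<in>V. A i) \<subseteq> C" using i0 V el by (auto simp: election_def)
  \<comment> \<open>Otherwise \<open>i0\<close> would already have \<open>l\<close> representatives
    in \<open>W\<close>.\<close>
  have "\<not> (\<Inter>i\<in>V. A i) \<subseteq> W"
  proof
    assume "(\<Inter>i\<in>V. A i) \<subseteq> W"
    then have "(\<Inter>i\<in>V. A i) \<subseteq> A i0 \<inter> W" using i0 by blast
    then have "card (\<Inter>i\<in>V. A i) \<le> card (A i0 \<inter> W)" using finW by (intro card_mono) auto
    then show False using l under[OF i0] by (simp add: W_def)
  qed
  then obtain c where c: "c \<in> C" "c \<notin> W" "\<And>i. i \<in> V \<Longrightarrow> c \<in> A i" using TC by blast
  obtain t where t: "t < card C - k" "c \<in> remaining n C A prio t"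
    "c = removed_candidate n A prio (remaining n C A prio t)"
    using removal_step_exists[OF c(1) c(2)[unfolded W_def reverse_seq_PAV_def]] by blast
  define S where "S = remaining n C A prio t"
  \<comment> \<open>The number of removals leading from \<open>S\<close> to \<open>W\<close>. It
    includes the removal of \<open>c\<close>, hence \<open>j\<close> is at least 1.\<close>
  define j where "j = card C - k - t"
  have S: "S \<subseteq> C" "card S = k + j"
    using remaining_subset_card[OF fin lin, of t n A] t(1) k by (auto simp: S_def j_def)
  have finS: "finite S" using S fin finite_subset by blast
  have WS: "W \<subseteq> S"
    unfolding W_def S_def reverse_seq_PAV_def
    using antimonoD[OF antimono_remaining, of t "card C - k" n C A prio] t(1) by simp
  have cS: "c \<in> S" using t(2) by (simp add: S_def)
  have least: "c \<in> least_loss n A S"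
    using removed_candidate_least_loss(1)[OF fin lin S(1), of n A] t(3) cS
    by (auto simp: S_def)
  \<comment> \<open>Passing from \<open>W\<close> back to \<open>S\<close> adds \<open>j\<close>
    candidates, so a voter gains at most \<open>j\<close> representatives.\<close>
  have q: "card (A i \<inter> S) \<le> l - 1 + j" if i: "i \<in> V" for i
  proof -
    have "card (A i \<inter> S) \<le> card ((A i \<inter> W) \<union> (S - W))"
      using finS finW by (intro card_mono) auto
    also have "\<dots> \<le> card (A i \<inter> W) + card (S - W)" by (rule card_Un_le)
    also have "card (S - W) = j" using card_Diff_subset[OF finW WS] S W by simp
    finally show ?thesis using under[OF i] by (simp add: W_def)
  qed
  have "real (card V) * real (card S) \<le>
      real (l - 1 + j) * marginal_loss n A S c * real (card S)"
    using marginal_loss_ge_group[OF finS cS V(1) c(3) q] by (intro mult_right_mono) auto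
  also have "\<dots> = real (l - 1 + j) * (real (card S) * marginal_loss n A S c)" by simp
  also have "\<dots> \<le> real (l - 1 + j) * real n"
    by (intro mult_left_mono least_loss_le_average[OF finS least]) auto
  finally have "real (card V) * (real k + real j) \<le> real n * (real l - 1 + real j)"
    using S l1 by (simp add: algebra_simps of_nat_diff)
  moreover have "1 \<le> j" "j \<le> card C - k" using t(1) by (auto simp: j_def)
  ultimately show thesis using that by blast
qed

text \<open>Here \<open>q\<close> measures the group size in units of n/k: it is \<open>r\<close>
  times \<open>l\<close> for the approximation claim and \<open>l\<close> for cohesive groups. The
  assumption \<open>gap\<close> is what contradicts the previous bound once this size is inserted
  and n is cancelled.\<close>

lemma large_group_represented:
  assumes el: "election n C A k" and lin: "linear_order_on C prio"
    and V: "V \<subseteq> {1..n}" and l: "card (\<Inter>i\<in>V. A i) \<ge> l"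
    and q: "q > 0" "real (card V) \<ge> q * real n / real k"
    and gap: "\<And>j::nat. 1 \<le> j \<Longrightarrow> j \<le> card C - k \<Longrightarrow>
      real k * (real l - 1 + real j) < q * (real k + real j)"
  shows "\<exists>i\<in>V. card (A i \<inter> reverse_seq_PAV n C A k prio) \<ge> l"
proof (rule ccontr)
  assume "\<not> ?thesis"
  then have under: "\<And>i. i \<in> V \<Longrightarrow> card (A i \<inter> reverse_seq_PAV n C A k prio) < l"
    by force
  have n: "real n > 0" and k: "real k > 0" using el by (auto simp: election_def)
  \<comment> \<open>This excludes the empty group, whose intersection of ballots would be the whole
    type.\<close>
  have "real (card V) > 0" using q n k by (smt (verit) divide_pos_pos mult_pos_pos)
  then have "V \<noteq> {}" by auto
  then obtain j where j: "1 \<le> j" "j \<le> card C - k"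
    and le: "real (card V) * (real k + real j) \<le> real n * (real l - 1 + real j)"
    using underrepresented_group_bound[OF el lin V _ l under] by blast
  have "real n * (real k * (real l - 1 + real j)) < real n * (q * (real k + real j))"
    using gap[OF j] n by simp
  also have "\<dots> = (q * real n) * (real k + real j)" by simp
  also have "\<dots> \<le> (real (card V) * real k) * (real k + real j)"
    using q(2) k by (intro mult_right_mono) (auto simp: field_simps)
  also have "\<dots> = real k * (real (card V) * (real k + real j))" by simp
  also have "\<dots> \<le> real k * (real n * (real l - 1 + real j))"
    using le k by simp
  finally show False by (simp add: mult.left_commute)
qed

theorem corollary4:
  fixes n k r :: nat and C W :: "'c set" and A :: "nat \<Rightarrow> 'c set" and prio :: "'c rel"
  assumes "election n C A k"
    and "linear_order_on C prio"
    and "r = card C - k"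
    and "W = reverse_seq_PAV n C A k prio"
  shows "beta_EJR (1 / real r) n A k W \<and>
    (\<forall>l::nat. l \<ge> 1 \<and> real l > real k * (1 - 1 / real r) \<longrightarrow>
      (\<forall>V. cohesive n A k l V \<longrightarrow> (\<exists>i\<in>V. card (A i \<inter> W) \<ge> l)))"
proof
  have k: "real k > 0" and r: "real r \<ge> 1" using assms(1,3) by (auto simp: election_def)
  show "beta_EJR (1 / real r) n A k W"
    unfolding beta_EJR_def
  proof (intro allI impI, elim conjE)
    fix l :: nat and V
    assume l: "1 \<le> l" and V: "V \<subseteq> {1..n}" "card (\<Inter>i\<in>V. A i) \<ge> l"
      and big: "real (card V) \<ge> 1 / (1 / real r) * real l * (real n / real k)"
    have "real k * (real l - 1 + real j) < real r * real l * (real k + real j)"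
      if j: "1 \<le> j" "j \<le> card C - k" for j :: nat
    proof -
      \<comment> \<open>Expanded, this reads l - 1 + r \<le> r l, which covers every j \<le>
        r.\<close>
      have "(real r - 1) * (real l - 1) \<ge> 0" using r l by simp
      then have "real l - 1 + real j \<le> real r * real l"
        using j assms(3) by (simp add: algebra_simps)
      then have "real k * (real l - 1 + real j) \<le> real k * (real r * real l)"
        using k by simp
      \<comment> \<open>The strictness of the gap comes from this remaining term.\<close>
      moreover have "real r * real l * real j > 0" using r l j by simp
      ultimately show ?thesis by (simp add: algebra_simps)
    qed
    then show "\<exists>i\<in>V. card (A i \<inter> W) \<ge> l"
      unfolding assms(4) using big r l
      by (intro large_group_represented[OF assms(1,2) V, of "real r * real l"]) auto
  qed
  show "\<forall>l::nat. l \<ge> 1 \<and> real l > real k * (1 - 1 / real r) \<longrightarrow>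
      (\<forall>V. cohesive n A k l V \<longrightarrow> (\<exists>i\<in>V. card (A i \<inter> W) \<ge> l))"
  proof (intro allI impI, elim conjE)
    fix l :: nat and V
    assume l: "1 \<le> l" "real l > real k * (1 - 1 / real r)" and V: "cohesive n A k l V"
    have "real k * (real l - 1 + real j) < real l * (real k + real j)"
      if j: "1 \<le> j" "j \<le> card C - k" for j :: nat
    proof -
      \<comment> \<open>After cancelling k l, the goal is k (j - 1) < l j, that is, l > k (1 - 1/j).
        This threshold grows with j, so the case j = r, which is the hypothesis on l, is the
        hardest.\<close>
      have "1 / real r \<le> 1 / real j" using j assms(3) by (simp add: frac_le)
      then have "real k * (1 - 1 / real j) \<le> real k * (1 - 1 / real r)" using k by simp
      then have "real k * (1 - 1 / real j) < real l" using l(2) by linarith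
      then show ?thesis using j by (simp add: field_simps)
    qed
    then show "\<exists>i\<in>V. card (A i \<inter> W) \<ge> l"
      unfolding assms(4) using V l(1)
      by (intro large_group_represented[OF assms(1,2), of V l "real l"])
        (auto simp: cohesive_def)
  qed
qed

end
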